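(* Let $T$ be a finite nonempty set and let $X=(X_t)_{t\in T}$ be a centered (jointly) Gaussian process with $\mathbf{E}|X_s-X_t|^2>0$ for all $s\neq t$. Let $\sigma^2:=\max_{t\in T}\mathrm{Var}[X_t]$. Then for every $\beta\ge 0$ the quenched Gibbs average $g(\beta)$ satisfies $$g(\beta)\le \sqrt{2\sigma^2\,\mathbf{E} D(\nu_\beta\|\nu_0)}.$$
   Context: For $\beta\ge 0$, the random Gibbs measure $\nu_\beta$ on $T$ is the probability measure with $\nu_\beta(t)=e^{\beta X_t}/Z(\beta)$, $t\in T$, where $Z(\beta)=\sum_{t\in T}e^{\beta X_t}$; in particular $\nu_0$ is the uniform distribution on $T$. The quenched Gibbs average is $g(\beta):=\mathbf{E}\big[\frac{1}{Z(\beta)}\sum_{t\in T}X_te^{\beta X_t}\big]=\mathbf{E}\big[\sum_{t\in T}X_t\nu_\beta(t)\big]$. $D(\mu\|\nu)=\sum_{t\in T}\mu(t)\log\frac{\mu(t)}{\nu(t)}$ is the Kullback–Leibler divergence (natural logarithm), and $\mathbf{E}$ is expectation with respect to the randomness of $X$. *)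

theory Defs
  imports "HOL-Probability.Probability"
begin

text \<open>
  Constants count as (degenerate) Gaussian random variables, so covariance matrices
  are allowed to be singular. For a non-degenerate one the second argument of
  \<^const>\<open>normal_density\<close> is the standard deviation.
\<close>

definition gaussian_rv :: "'w measure \<Rightarrow> ('w \<Rightarrow> real) \<Rightarrow> bool" where
  "gaussian_rv M Y \<longleftrightarrow> Y \<in> borel_measurable M \<and>
     ((\<exists>\<mu> \<sigma>. 0 < \<sigma> \<and> distributed M lborel Y (normal_density \<mu> \<sigma>)) \<or>
      (\<exists>\<mu>. AE \<omega> in M. Y \<omega> = \<mu>))"

text \<open>Joint Gaussianity: every finite linear combination is a Gaussian random variable.\<close>

definition gaussian_process :: "'w measure \<Rightarrow> 't set \<Rightarrow> ('t \<Rightarrow> 'w \<Rightarrow> real) \<Rightarrow> bool" where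
  "gaussian_process M T X \<longleftrightarrow>
     (\<forall>J c. finite J \<and> J \<subseteq> T \<longrightarrow> gaussian_rv M (\<lambda>\<omega>. \<Sum>t\<in>J. c t * X t \<omega>))"

definition centered_gaussian_process :: "'w measure \<Rightarrow> 't set \<Rightarrow> ('t \<Rightarrow> 'w \<Rightarrow> real) \<Rightarrow> bool" where
  "centered_gaussian_process M T X \<longleftrightarrow>
     gaussian_process M T X \<and> (\<forall>t\<in>T. prob_space.expectation M (X t) = 0)"

text \<open>Here \<open>x\<close> is one realisation \<open>t \<mapsto> X t \<omega>\<close> of the process.\<close>

definition partition_fun :: "'t set \<Rightarrow> real \<Rightarrow> ('t \<Rightarrow> real) \<Rightarrow> real" where
  "partition_fun T \<beta> x = (\<Sum>t\<in>T. exp (\<beta> * x t))"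

definition gibbs_weight :: "'t set \<Rightarrow> real \<Rightarrow> ('t \<Rightarrow> real) \<Rightarrow> 't \<Rightarrow> real" where
  "gibbs_weight T \<beta> x t = exp (\<beta> * x t) / partition_fun T \<beta> x"

definition gibbs_measure :: "'t set \<Rightarrow> real \<Rightarrow> ('t \<Rightarrow> real) \<Rightarrow> 't measure" where
  "gibbs_measure T \<beta> x = point_measure T (gibbs_weight T \<beta> x)"

definition quenched_gibbs_average ::
    "'w measure \<Rightarrow> 't set \<Rightarrow> ('t \<Rightarrow> 'w \<Rightarrow> real) \<Rightarrow> real \<Rightarrow> real" where
  "quenched_gibbs_average M T X \<beta> =
     prob_space.expectation M (\<lambda>\<omega>. \<Sum>t\<in>T. X t \<omega> * gibbs_weight T \<beta> (\<lambda>s. X s \<omega>) t)"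

text \<open>
  The reference measure is the second argument of \<open>kl_div\<close>, but comes first in
  \<^const>\<open>KL_divergence\<close>; base \<open>exp 1\<close> is the natural logarithm.
\<close>

definition kl_div :: "'t measure \<Rightarrow> 't measure \<Rightarrow> real" where
  "kl_div \<mu> \<nu> = KL_divergence (exp 1) \<nu> \<mu>"

lemma partition_fun_pos:
  assumes "finite T" "T \<noteq> {}"
  shows "0 < partition_fun T \<beta> x"
  unfolding partition_fun_def using assms by (intro sum_pos) auto

lemma gibbs_weight_pos:
  assumes "finite T" "T \<noteq> {}"
  shows "0 < gibbs_weight T \<beta> x t"
  unfolding gibbs_weight_def using partition_fun_pos[OF assms] by simp

lemma sum_gibbs_weight:
  assumes "finite T" "T \<noteq> {}"
  shows "(\<Sum>t\<in>T. gibbs_weight T \<beta> x t) = 1"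
proof -
  have "(\<Sum>t\<in>T. gibbs_weight T \<beta> x t) = partition_fun T \<beta> x / partition_fun T \<beta> x"
    unfolding gibbs_weight_def sum_divide_distrib[symmetric] by (simp add: partition_fun_def)
  then show ?thesis
    using partition_fun_pos[OF assms, of \<beta> x] by simp
qed

lemma prob_space_gibbs_measure:
  assumes "finite T" "T \<noteq> {}"
  shows "prob_space (gibbs_measure T \<beta> x)"
proof
  have "emeasure (gibbs_measure T \<beta> x) (space (gibbs_measure T \<beta> x))
      = (\<Sum>t\<in>T. ennreal (gibbs_weight T \<beta> x t))"
    unfolding gibbs_measure_def using assms
    by (simp add: space_point_measure emeasure_point_measure_finite)
  also have "\<dots> = ennreal (\<Sum>t\<in>T. gibbs_weight T \<beta> x t)"
    using gibbs_weight_pos[OF assms] by (intro sum_ennreal) (simp add: less_imp_le)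
  finally show "emeasure (gibbs_measure T \<beta> x) (space (gibbs_measure T \<beta> x)) = 1"
    by (simp add: sum_gibbs_weight[OF assms])
qed

lemma measure_gibbs_measure:
  assumes "finite T" "t \<in> T"
  shows "measure (gibbs_measure T \<beta> x) {t} = gibbs_weight T \<beta> x t"
proof -
  have "T \<noteq> {}" using assms by auto
  then show ?thesis
    using assms gibbs_weight_pos[of T \<beta> x t]
    by (simp add: gibbs_measure_def measure_def emeasure_point_measure_finite less_imp_le)
qed

lemma gibbs_measure_0: "gibbs_measure T 0 x = uniform_count_measure T"
  by (simp add: gibbs_measure_def gibbs_weight_def[abs_def] partition_fun_def
      uniform_count_measure_def)

lemma kl_div_gibbs_measure:
  assumes "finite T" "T \<noteq> {}"
  shows "kl_div (gibbs_measure T \<beta> x) (gibbs_measure T \<gamma> y) =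
    (\<Sum>t\<in>T. gibbs_weight T \<beta> x t * ln (gibbs_weight T \<beta> x t / gibbs_weight T \<gamma> y t))"
proof -
  interpret sigma_finite_measure "count_space T"
    using assms by (intro sigma_finite_measure_count_space_finite)
  have "KL_divergence (exp 1) (density (count_space T) (gibbs_weight T \<gamma> y))
      (density (count_space T) (gibbs_weight T \<beta> x)) =
    (\<integral>t. gibbs_weight T \<beta> x t * log (exp 1) (gibbs_weight T \<beta> x t / gibbs_weight T \<gamma> y t)
      \<partial>count_space T)"
    using gibbs_weight_pos[OF assms]
    by (intro KL_density_density) (auto simp: less_imp_le less_imp_neq[THEN not_sym])
  then show ?thesis
    using assms by (simp add: kl_div_def gibbs_measure_def point_measure_def
        lebesgue_integral_count_space_finite log_def)
qed

end

theory Submission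
  imports Defs
begin

text \<open>
  With \<open>w = gibbs_weight T \<beta> X\<close>, \<open>n = card T\<close>, and any \<open>a\<close> and \<open>c\<close>, the bound \<open>ln y \<le> y - 1\<close> gives
  \<open>w t * (a * X t - ln (n * w t) - c) \<le> exp (a * X t - c) / n - w t\<close>.
  Summing over \<open>t\<close> and choosing \<open>c = a\<^sup>2 \<sigma>\<^sup>2 / 2\<close>, the Gaussian moment generating function
  makes the expectation of the right-hand side nonpositive. Hence \<open>a * g \<le> E D + a\<^sup>2 \<sigma>\<^sup>2 / 2\<close> for
  every real \<open>a\<close>, and optimising over \<open>a\<close> gives the claim.
\<close>

text \<open>Completing the square: an exponential tilt moves the mean from 0 to
  \<open>a * \<sigma>\<^sup>2\<close> and keeps the variance. The prefactor is the moment generating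
  function.\<close>

lemma normal_density_exp_tilt:
  assumes "0 < \<sigma>"
  shows "normal_density 0 \<sigma> x * exp (a * x) = exp (a\<^sup>2 * \<sigma>\<^sup>2 / 2) * normal_density (a * \<sigma>\<^sup>2) \<sigma> x"
proof -
  have "- (x\<^sup>2 / (2 * \<sigma>\<^sup>2)) + a * x = a\<^sup>2 * \<sigma>\<^sup>2 / 2 + - ((x - a * \<sigma>\<^sup>2)\<^sup>2 / (2 * \<sigma>\<^sup>2))"
    using assms by (simp add: field_simps power2_eq_square)
  then show ?thesis
    by (simp add: normal_density_def exp_add[symmetric])
qed

text \<open>The moment generating function of a centered Gaussian. The
  \<open>has_bochner_integral\<close> form delivers integrability and value together, and the
  degenerate case fits the same formula with variance 0.\<close>

lemma (in prob_space) centered_gaussian_rv_exp_moment: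
  assumes "gaussian_rv M Y" and "expectation Y = 0"
  shows "has_bochner_integral M (\<lambda>\<omega>. exp (a * Y \<omega>)) (exp (a\<^sup>2 * variance Y / 2))"
proof -
  have meas [measurable]: "Y \<in> borel_measurable M"
    using assms(1) by (simp add: gaussian_rv_def)
  consider \<mu> \<sigma> where "0 < \<sigma>" "distributed M lborel Y (normal_density \<mu> \<sigma>)"
    | \<mu> where "AE \<omega> in M. Y \<omega> = \<mu>"
    using assms(1) unfolding gaussian_rv_def by blast
  then show ?thesis
  proof cases
    case (1 \<mu> \<sigma>)
    have "\<mu> = 0"
      using normal_distributed_expectation[OF 1] assms(2) by simp
    then have D: "distributed M lborel Y (normal_density 0 \<sigma>)"
      using 1 by simp
    have var: "variance Y = \<sigma>\<^sup>2"
      using normal_distributed_variance[OF 1] .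
    \<comment> \<open>After the tilt the integrand is a constant times a normal density, which has
      total mass 1.\<close>
    have "integrable M (\<lambda>\<omega>. exp (a * Y \<omega>))"
      using distributed_integrable[OF D, of "\<lambda>x. exp (a * x)"] 1(1)
      by (simp add: normal_density_exp_tilt integrable_normal_density)
    moreover have "expectation (\<lambda>\<omega>. exp (a * Y \<omega>)) = exp (a\<^sup>2 * \<sigma>\<^sup>2 / 2)"
      using distributed_integral[OF D, of "\<lambda>x. exp (a * x)"] 1(1)
      by (simp add: normal_density_exp_tilt integral_normal_density)
    ultimately show ?thesis
      unfolding var by (simp add: has_bochner_integral_iff)
  next
    case (2 \<mu>)
    have "expectation Y = expectation (\<lambda>_. \<mu>)"
      using 2 by (intro integral_cong_AE) auto
    then have "\<mu> = 0"
      using assms(2) by (simp add: prob_space)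
    then have AE0: "AE \<omega> in M. Y \<omega> = 0"
      using 2 by simp
    have "variance Y = expectation (\<lambda>_. 0)"
      using AE0 by (intro integral_cong_AE) (auto simp: assms(2))
    moreover have "has_bochner_integral M (\<lambda>\<omega>. exp (a * Y \<omega>)) 1
        \<longleftrightarrow> has_bochner_integral M (\<lambda>_. 1 :: real) 1"
      using AE0 by (intro has_bochner_integral_cong_AE) auto
    ultimately show ?thesis
      by (simp add: has_bochner_integral_iff prob_space)
  qed
qed

text \<open>Domination by the exponential moments at 1 and -1. Mean zero alone would not give
  integrability, because the integral of a non-integrable function is 0 by convention.\<close>

lemma (in prob_space) centered_gaussian_rv_integrable:
  assumes "gaussian_rv M Y" and "expectation Y = 0"
  shows "integrable M Y"
proof (rule Bochner_Integration.integrable_bound)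
  show "integrable M (\<lambda>\<omega>. exp (1 * Y \<omega>) + exp (- 1 * Y \<omega>))"
    using centered_gaussian_rv_exp_moment[OF assms]
    by (intro Bochner_Integration.integrable_add) (blast dest: has_bochner_integral_iff[THEN iffD1])+
  show "Y \<in> borel_measurable M"
    using assms(1) by (simp add: gaussian_rv_def)
  have "\<bar>y\<bar> \<le> exp y + exp (- y)" for y :: real
    using exp_ge_add_one_self[of y] exp_ge_add_one_self[of "- y"] exp_gt_zero[of y] exp_gt_zero[of "- y"]
    by linarith
  then show "AE \<omega> in M. norm (Y \<omega>) \<le> norm (exp (1 * Y \<omega>) + exp (- 1 * Y \<omega>))"
    by (intro AE_I2) (simp add: abs_of_pos add_pos_pos)
qed

text \<open>Optimisation over \<open>a\<close>: for positive \<open>s\<close> the gap between the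
  two sides of \<open>bound\<close> is smallest at \<open>a = g / s\<close>.\<close>

lemma le_sqrt_of_quadratic_bound:
  fixes g s d :: real
  assumes "0 \<le> s" and bound: "\<And>a. a * g \<le> d + a\<^sup>2 * s / 2"
  shows "g \<le> sqrt (2 * s * d)"
proof (cases "s = 0")
  case True
  then have "g \<le> 0"
    \<comment> \<open>Without the quadratic term the bound reads \<open>a * g \<le> d\<close>. For
      nonzero \<open>g\<close> this choice of \<open>a\<close> makes the left side
      \<open>d + 1\<close>, a contradiction.\<close>
    using bound[of "(d + 1) / g"] by (cases "g = 0") auto
  then show ?thesis using True by simp
next
  case False
  then have "g\<^sup>2 \<le> 2 * s * d"
    using bound[of "g / s"] assms(1) by (simp add: field_simps power2_eq_square)
  then show ?thesis by (rule real_le_rsqrt)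
qed

text \<open>A bound independent of \<open>w\<close>: it makes each summand of the divergence a
  bounded random variable, hence integrable. The singularity of \<open>ln\<close> at 0 is tamed by
  \<open>ln (1 / w) \<le> 1 / w - 1\<close>.\<close>

lemma abs_mult_ln_le:
  fixes w n :: real
  assumes "0 < w" "w \<le> 1" "1 \<le> n"
  shows "\<bar>w * ln (w * n)\<bar> \<le> 1 + n"
proof -
  have "- ln w \<le> 1 / w - 1"
    using ln_le_minus_one[of "1 / w"] assms(1) by (simp add: ln_div)
  then have "w * - ln w \<le> w * (1 / w - 1)"
    using assms(1) by (intro mult_left_mono) auto
  then have "- (w * ln w) \<le> 1"
    using assms(1) by (simp add: algebra_simps)
  moreover have "w * ln w \<le> 0"
    using assms by (simp add: mult_le_0_iff)
  moreover have "0 \<le> w * ln n" using assms by simp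
  moreover have "w * ln n \<le> 1 * n"
    using assms ln_le_minus_one[of n] by (intro mult_mono) auto
  moreover have "w * ln (w * n) = w * ln w + w * ln n"
    using assms by (simp add: ln_mult distrib_left)
  ultimately show ?thesis
    using assms(3) by linarith
qed

lemma gibbs_weight_le_1:
  assumes "finite T" "t \<in> T"
  shows "gibbs_weight T \<beta> x t \<le> 1"
proof -
  have ne: "T \<noteq> {}" using assms by auto
  have "gibbs_weight T \<beta> x t \<le> (\<Sum>s\<in>T. gibbs_weight T \<beta> x s)"
    using assms gibbs_weight_pos[OF assms(1) ne] by (intro member_le_sum) (auto simp: less_imp_le)
  then show ?thesis
    by (simp add: sum_gibbs_weight[OF assms(1) ne])
qed

lemma kl_div_gibbs_measure_0:
  assumes "finite T" "T \<noteq> {}"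
  shows "kl_div (gibbs_measure T \<beta> x) (gibbs_measure T 0 x) =
    (\<Sum>t\<in>T. gibbs_weight T \<beta> x t * ln (gibbs_weight T \<beta> x t * card T))"
  by (simp add: kl_div_gibbs_measure[OF assms] gibbs_weight_def[of T 0] partition_fun_def[of T 0])

text \<open>A linearised Gibbs variational inequality for one fixed realisation. The usual logarithm
  of the mean of \<open>exp (a * x t)\<close> is replaced by its tangent bound, so that expectations
  can later be taken term by term.\<close>

lemma gibbs_average_le_kl_div:
  assumes "finite T" "T \<noteq> {}"
  shows "a * (\<Sum>t\<in>T. x t * gibbs_weight T \<beta> x t) \<le>
    kl_div (gibbs_measure T \<beta> x) (gibbs_measure T 0 x) + c
      + ((\<Sum>t\<in>T. exp (a * x t - c)) / card T - 1)"
proof -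
  let ?n = "real (card T)" and ?w = "gibbs_weight T \<beta> x"
  have n: "0 < ?n" using assms by (simp add: card_gt_0_iff)
  have w: "0 < ?w t" for t using gibbs_weight_pos[OF assms] .
  have le: "?w t * (a * x t) \<le> ?w t * ln (?w t * ?n) + c * ?w t + (exp (a * x t - c) / ?n - ?w t)" for t
  proof -
    \<comment> \<open>The ratio of the tilted uniform weight \<open>exp (a * x t - c) / ?n\<close>
      to the Gibbs weight; multiplying by \<open>?w t\<close> later cancels the denominator.\<close>
    define y where "y = exp (a * x t - c) / (?w t * ?n)"
    have "ln y = a * x t - c - ln (?w t * ?n)"
      unfolding y_def using n w[of t] by (subst ln_div) auto
    moreover have "ln y \<le> y - 1"
      unfolding y_def using n w[of t] by (intro ln_le_minus_one) auto
    ultimately have "?w t * (a * x t - c - ln (?w t * ?n)) \<le> ?w t * (y - 1)"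
      using w[of t] by (intro mult_left_mono) auto
    moreover have "?w t * y = exp (a * x t - c) / ?n"
      unfolding y_def using n w[of t] by simp
    ultimately show ?thesis by (simp add: algebra_simps)
  qed
  have "a * (\<Sum>t\<in>T. x t * ?w t) = (\<Sum>t\<in>T. ?w t * (a * x t))"
    by (simp add: sum_distrib_left mult_ac)
  also have "\<dots> \<le> (\<Sum>t\<in>T. ?w t * ln (?w t * ?n) + c * ?w t + (exp (a * x t - c) / ?n - ?w t))"
    by (intro sum_mono le)
  \<comment> \<open>The weights sum to 1, which turns \<open>c * ?w t\<close> into \<open>c\<close>
    and \<open>- ?w t\<close> into -1.\<close>
  also have "\<dots> = (\<Sum>t\<in>T. ?w t * ln (?w t * ?n)) + c + ((\<Sum>t\<in>T. exp (a * x t - c)) / ?n - 1)"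
    by (simp add: sum.distrib sum_subtractf sum_distrib_left[symmetric] sum_divide_distrib[symmetric]
        sum_gibbs_weight[OF assms])
  finally show ?thesis
    by (simp add: kl_div_gibbs_measure_0[OF assms])
qed

theorem theorem1:
  fixes M :: "'w measure" and T :: "'t set" and X :: "'t \<Rightarrow> 'w \<Rightarrow> real" and \<beta> :: real
  assumes "prob_space M"
    and "finite T" and "T \<noteq> {}"
    and "centered_gaussian_process M T X"
    and "\<And>s t. s \<in> T \<Longrightarrow> t \<in> T \<Longrightarrow> s \<noteq> t \<Longrightarrow>
           0 < prob_space.expectation M (\<lambda>\<omega>. \<bar>X s \<omega> - X t \<omega>\<bar>\<^sup>2)"
    and "0 \<le> \<beta>"
  shows "quenched_gibbs_average M T X \<beta> \<le>
    sqrt (2 * (MAX t\<in>T. prob_space.variance M (X t)) *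
      prob_space.expectation M
        (\<lambda>\<omega>. kl_div (gibbs_measure T \<beta> (\<lambda>t. X t \<omega>)) (gibbs_measure T 0 (\<lambda>t. X t \<omega>))))"
proof -
  interpret prob_space M by fact
  let ?w = "\<lambda>\<omega>. gibbs_weight T \<beta> (\<lambda>s. X s \<omega>)"
  let ?kl = "\<lambda>\<omega>. kl_div (gibbs_measure T \<beta> (\<lambda>t. X t \<omega>)) (gibbs_measure T 0 (\<lambda>t. X t \<omega>))"
  define \<sigma>2 where "\<sigma>2 = (MAX t\<in>T. variance (X t))"
  note fin = \<open>finite T\<close> \<open>T \<noteq> {}\<close>
  have gauss: "gaussian_rv M (X t)" and centered: "expectation (X t) = 0" if "t \<in> T" for t
  proof -
    \<comment> \<open>Each marginal is the one-term linear combination with coefficient 1.\<close>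
    have "gaussian_rv M (\<lambda>\<omega>. \<Sum>s\<in>{t}. (\<lambda>_. 1) s * X s \<omega>)"
      using assms(4) that unfolding centered_gaussian_process_def gaussian_process_def
      by (elim conjE allE[of _ "{t}"] allE[of _ "\<lambda>_. 1"]) auto
    then show "gaussian_rv M (X t)" by simp
    show "expectation (X t) = 0"
      using assms(4) that by (simp add: centered_gaussian_process_def)
  qed
  have X_meas [measurable]: "X t \<in> borel_measurable M" if "t \<in> T" for t
    using gauss[OF that] by (simp add: gaussian_rv_def)
  have X_int: "integrable M (X t)" if "t \<in> T" for t
    using centered_gaussian_rv_integrable[OF gauss[OF that] centered[OF that]] .
  have Z_meas [measurable]: "(\<lambda>\<omega>. partition_fun T \<beta> (\<lambda>s. X s \<omega>)) \<in> borel_measurable M"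
    unfolding partition_fun_def by measurable
  have w_meas [measurable]: "(\<lambda>\<omega>. ?w \<omega> t) \<in> borel_measurable M" if "t \<in> T" for t
    unfolding gibbs_weight_def using that by measurable
  have w_bounds: "0 < ?w \<omega> t" "?w \<omega> t \<le> 1" if "t \<in> T" for t \<omega>
    using gibbs_weight_pos[OF fin] gibbs_weight_le_1[OF fin(1) that] by auto
  have avg_int: "integrable M (\<lambda>\<omega>. \<Sum>t\<in>T. X t \<omega> * ?w \<omega> t)"
  proof (intro Bochner_Integration.integrable_sum)
    fix t assume t: "t \<in> T"
    show "integrable M (\<lambda>\<omega>. X t \<omega> * ?w \<omega> t)"
    \<comment> \<open>The random weight lies between 0 and 1, so \<open>X t\<close> dominates the
      product.\<close>
    proof (rule Bochner_Integration.integrable_bound[OF X_int[OF t]])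
      show "(\<lambda>\<omega>. X t \<omega> * ?w \<omega> t) \<in> borel_measurable M" using t by measurable
      show "AE \<omega> in M. norm (X t \<omega> * ?w \<omega> t) \<le> norm (X t \<omega>)"
        using w_bounds[OF t] by (intro AE_I2) (simp add: abs_mult abs_of_pos mult_left_le)
    qed
  qed
  have card: "1 \<le> real (card T)"
    using fin by (simp add: Suc_le_eq card_gt_0_iff)
  have kl_int: "integrable M ?kl"
    unfolding kl_div_gibbs_measure_0[OF fin]
  proof (intro Bochner_Integration.integrable_sum)
    fix t assume t: "t \<in> T"
    show "integrable M (\<lambda>\<omega>. ?w \<omega> t * ln (?w \<omega> t * card T))"
    proof (rule integrable_const_bound[where B = "1 + card T"])
      show "AE \<omega> in M. norm (?w \<omega> t * ln (?w \<omega> t * card T)) \<le> 1 + card T"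
        using abs_mult_ln_le[OF w_bounds[OF t] card] by (intro AE_I2) simp
      show "(\<lambda>\<omega>. ?w \<omega> t * ln (?w \<omega> t * card T)) \<in> borel_measurable M" using t by measurable
    qed
  qed
  have var_le: "variance (X t) \<le> \<sigma>2" if "t \<in> T" for t
    unfolding \<sigma>2_def using fin that by (intro Max_ge) auto
  have "0 \<le> \<sigma>2"
  proof -
    obtain t where "t \<in> T" using fin by auto
    from order_trans[OF variance_positive var_le[OF this]] show ?thesis .
  qed
  moreover have "a * quenched_gibbs_average M T X \<beta> \<le> expectation ?kl + a\<^sup>2 * \<sigma>2 / 2" for a
  proof -
    \<comment> \<open>The largest logarithmic moment generating function over \<open>T\<close>:
      dividing by \<open>exp c\<close> brings every exponential moment down to at most 1, and so
      their average too.\<close>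
    define c where "c = a\<^sup>2 * \<sigma>2 / 2"
    have moment: "has_bochner_integral M (\<lambda>\<omega>. exp (a * X t \<omega> - c)) (exp (a\<^sup>2 * variance (X t) / 2 - c))"
      if "t \<in> T" for t
      using has_bochner_integral_divide_zero[OF
          centered_gaussian_rv_exp_moment[OF gauss[OF that] centered[OF that], of a], of "exp c"]
      by (simp add: exp_diff)
    have exp_int: "has_bochner_integral M (\<lambda>\<omega>. (\<Sum>t\<in>T. exp (a * X t \<omega> - c)) / card T)
        ((\<Sum>t\<in>T. exp (a\<^sup>2 * variance (X t) / 2 - c)) / card T)"
      by (intro has_bochner_integral_divide_zero has_bochner_integral_sum moment)
    have exp_integrable: "integrable M (\<lambda>\<omega>. (\<Sum>t\<in>T. exp (a * X t \<omega> - c)) / card T)"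
      using exp_int by (rule integrable.intros)
    have "exp (a\<^sup>2 * variance (X t) / 2 - c) \<le> 1" if "t \<in> T" for t
      unfolding c_def using var_le[OF that] by (simp add: mult_left_mono)
    then have "(\<Sum>t\<in>T. exp (a\<^sup>2 * variance (X t) / 2 - c)) \<le> (\<Sum>t\<in>T. 1)"
      by (intro sum_mono)
    then have exp_le: "expectation (\<lambda>\<omega>. (\<Sum>t\<in>T. exp (a * X t \<omega> - c)) / card T) \<le> 1"
      using has_bochner_integral_integral_eq[OF exp_int] card by (simp add: divide_le_eq)
    have "a * quenched_gibbs_average M T X \<beta> = expectation (\<lambda>\<omega>. a * (\<Sum>t\<in>T. X t \<omega> * ?w \<omega> t))"
      by (simp add: quenched_gibbs_average_def)
    also have "\<dots> \<le> expectation (\<lambda>\<omega>. ?kl \<omega> + c + ((\<Sum>t\<in>T. exp (a * X t \<omega> - c)) / card T - 1))"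
    proof (rule integral_mono)
      show "integrable M (\<lambda>\<omega>. a * (\<Sum>t\<in>T. X t \<omega> * ?w \<omega> t))"
        using avg_int by (rule integrable_mult_right)
      show "integrable M (\<lambda>\<omega>. ?kl \<omega> + c + ((\<Sum>t\<in>T. exp (a * X t \<omega> - c)) / card T - 1))"
        by (intro Bochner_Integration.integrable_add Bochner_Integration.integrable_diff
            kl_int exp_integrable integrable_const)
    qed (rule gibbs_average_le_kl_div[OF fin])
    \<comment> \<open>The quotient by \<open>card T\<close> is kept inside the integral, where
      \<open>exp_le\<close> bounds it.\<close>
    also have "\<dots> = expectation ?kl + c
        + (expectation (\<lambda>\<omega>. (\<Sum>t\<in>T. exp (a * X t \<omega> - c)) / card T) - 1)"
      using kl_int exp_integrable prob_space
      by (simp del: integral_divide_zero integrable_divide_zero Bochner_Integration.integral_divide)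
    also have "\<dots> \<le> expectation ?kl + c"
      using exp_le by simp
    finally show ?thesis by (simp add: c_def)
  qed
  ultimately show ?thesis
    unfolding \<sigma>2_def by (rule le_sqrt_of_quadratic_bound)
qed

end
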